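(* Let $(G,\tau,\oplus)$ be a strongly topological gyrogroup which is feathered. Then the space $(G,\tau)$ is paracompact.
   Context: A gyrogroup is a nonempty set $G$ with a binary operation $\oplus$ such that: (G1) there is a unique identity element $0\in G$ with $0\oplus a=a=a\oplus 0$ for all $a\in G$; (G2) for each $x\in G$ there is a unique inverse $\ominus x\in G$ with $\ominus x\oplus x=0=x\oplus(\ominus x)$; (G3) for all $x,y\in G$ there is an automorphism $gyr[x,y]$ of $(G,\oplus)$ (a bijective homomorphism of $(G,\oplus)$ onto itself) such that $x\oplus(y\oplus z)=(x\oplus y)\oplus gyr[x,y](z)$ for all $z\in G$; (G4) $gyr[x\oplus y,y]=gyr[x,y]$ for all $x,y\in G$. A topological gyrogroup $(G,\tau,\oplus)$ is a gyrogroup $(G,\oplus)$ with a topology $\tau$ such that $\oplus:G\times G\to G$ is jointly continuous and $x\mapsto\ominus x$ is continuous. All topological gyrogroups are assumed to be $T_1$ spaces. A topological gyrogroup $G$ is a strongly topological gyrogroup if there is a neighborhood base $\mathscr U$ of $0$ such that $gyr[x,y](U)=U$ for every $U\in\mathscr U$ and all $x,y\in G$. The character of a space $X$ at a set $F\subset X$ is the smallest cardinality of a base for $X$ at $F$, i.e. of a family $\gamma$ of open sets, each containing $F$, such that every open set containing $F$ contains some member of $\gamma$. A topological gyrogroup $G$ is feathered if it contains a non-empty compact set $K$ of countable character in $G$. A space is paracompact if every open covering has a locally finite open refinement that is a covering. *)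

theory Defs
  imports "HOL-Analysis.Analysis" "HOL-Algebra.Group"
begin

unbundle cardinal_syntax

section \<open>Gyrogroups\<close>

text \<open>
  A gyrogroup is carried by the record type of magmas with a distinguished element from
  HOL-Algebra, so \<open>\<otimes>\<close>, \<open>\<one>\<close> and \<open>inv\<close> stand for the usual \<open>\<oplus>\<close>, \<open>0\<close> and \<open>\<ominus>\<close>; no associativity
  is assumed. The gyrations are a parameter. Their values on the carrier are uniquely
  determined by the operation (left cancellation), and their values elsewhere are irrelevant.
\<close>

locale gyrogroup =
  fixes G (structure) and gyr :: "'a \<Rightarrow> 'a \<Rightarrow> 'a \<Rightarrow> 'a"
  assumes op_closed: "\<lbrakk>x \<in> carrier G; y \<in> carrier G\<rbrakk> \<Longrightarrow> x \<otimes> y \<in> carrier G"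
    and zero_closed: "\<one> \<in> carrier G"
    and left_zero: "a \<in> carrier G \<Longrightarrow> \<one> \<otimes> a = a"
    and right_zero: "a \<in> carrier G \<Longrightarrow> a \<otimes> \<one> = a"
    and zero_unique:
      "\<lbrakk>e \<in> carrier G; \<And>a. a \<in> carrier G \<Longrightarrow> e \<otimes> a = a \<and> a \<otimes> e = a\<rbrakk> \<Longrightarrow> e = \<one>"
    and ex1_inverse: "x \<in> carrier G \<Longrightarrow> \<exists>!y. y \<in> carrier G \<and> y \<otimes> x = \<one> \<and> x \<otimes> y = \<one>"
    and gyr_automorphism: "\<lbrakk>x \<in> carrier G; y \<in> carrier G\<rbrakk> \<Longrightarrow> gyr x y \<in> iso G G"
    and gyroassociative:
      "\<lbrakk>x \<in> carrier G; y \<in> carrier G; z \<in> carrier G\<rbrakk>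
        \<Longrightarrow> x \<otimes> (y \<otimes> z) = (x \<otimes> y) \<otimes> gyr x y z"
    and loop_property:
      "\<lbrakk>x \<in> carrier G; y \<in> carrier G; z \<in> carrier G\<rbrakk>
        \<Longrightarrow> gyr (x \<otimes> y) y z = gyr x y z"


section \<open>Topological notions\<close>

text \<open>Neighbourhoods are not required to be open.\<close>

definition neighbourhood_base :: "'a topology \<Rightarrow> 'a \<Rightarrow> 'a set set \<Rightarrow> bool" where
  "neighbourhood_base X x \<U> \<longleftrightarrow>
     (\<forall>U\<in>\<U>. U \<subseteq> topspace X \<and> (\<exists>W. openin X W \<and> x \<in> W \<and> W \<subseteq> U)) \<and>
     (\<forall>W. openin X W \<and> x \<in> W \<longrightarrow> (\<exists>U\<in>\<U>. U \<subseteq> W))"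

definition base_at :: "'a topology \<Rightarrow> 'a set \<Rightarrow> 'a set set \<Rightarrow> bool" where
  "base_at X F \<gamma> \<longleftrightarrow>
     (\<forall>U\<in>\<gamma>. openin X U \<and> F \<subseteq> U) \<and>
     (\<forall>W. openin X W \<and> F \<subseteq> W \<longrightarrow> (\<exists>U\<in>\<gamma>. U \<subseteq> W))"

text \<open>
  Cardinal numbers are represented as cardinal orders, and the choice of a base of least
  cardinality determines the value up to \<open>=o\<close> only.
\<close>

definition character :: "'a topology \<Rightarrow> 'a set \<Rightarrow> 'a set rel" where
  "character X F =
     |SOME \<gamma>. base_at X F \<gamma> \<and> (\<forall>\<gamma>'. base_at X F \<gamma>' \<longrightarrow> |\<gamma>| \<le>o |\<gamma>'| )|"

definition countable_character :: "'a topology \<Rightarrow> 'a set \<Rightarrow> bool" where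
  "countable_character X F \<longleftrightarrow> character X F \<le>o natLeq"

definition paracompact_space :: "'a topology \<Rightarrow> bool" where
  "paracompact_space X \<longleftrightarrow>
     (\<forall>\<U>. (\<forall>U\<in>\<U>. openin X U) \<and> \<Union>\<U> = topspace X \<longrightarrow>
       (\<exists>\<V>. (\<forall>V\<in>\<V>. openin X V) \<and> \<Union>\<V> = topspace X \<and>
            (\<forall>V\<in>\<V>. \<exists>U\<in>\<U>. V \<subseteq> U) \<and> locally_finite_in X \<V>))"

lemma base_at_all_open: "base_at X F {U. openin X U \<and> F \<subseteq> U}"
  unfolding base_at_def by blast

lemma ex_least_base_at:
  "\<exists>\<gamma>. base_at X F \<gamma> \<and> (\<forall>\<gamma>'. base_at X F \<gamma>' \<longrightarrow> |\<gamma>| \<le>o |\<gamma>'| )"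
proof -
  let ?R = "card_of ` {\<gamma>. base_at X F \<gamma>}"
  have "?R \<noteq> {}" "\<forall>r\<in>?R. Card_order r"
    using base_at_all_open by (blast, auto simp: card_of_Card_order)
  from exists_minim_Card_order[OF this] show ?thesis by auto
qed

lemma countable_character_iff:
  "countable_character X F \<longleftrightarrow> (\<exists>\<gamma>. base_at X F \<gamma> \<and> countable \<gamma>)"
proof -
  define \<gamma>0 where
    "\<gamma>0 = (SOME \<gamma>. base_at X F \<gamma> \<and> (\<forall>\<gamma>'. base_at X F \<gamma>' \<longrightarrow> |\<gamma>| \<le>o |\<gamma>'| ))"
  have least: "base_at X F \<gamma>0" "\<And>\<gamma>'. base_at X F \<gamma>' \<Longrightarrow> |\<gamma>0| \<le>o |\<gamma>'|"
    using someI_ex[OF ex_least_base_at[of X F]] unfolding \<gamma>0_def by blast+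
  have cnt: "|\<gamma>| \<le>o natLeq \<longleftrightarrow> countable \<gamma>" for \<gamma> :: "'a set set"
  proof -
    have "|\<gamma>| \<le>o natLeq \<longleftrightarrow> |\<gamma>| \<le>o |UNIV :: nat set|"
      using ordLeq_ordIso_trans[OF _ card_of_nat]
        ordLeq_ordIso_trans[OF _ ordIso_symmetric[OF card_of_nat]] by (intro iffI)
    then show ?thesis
      unfolding countable_def card_of_ordLeq[symmetric] by simp
  qed
  have "countable_character X F \<longleftrightarrow> |\<gamma>0| \<le>o natLeq"
    by (simp add: countable_character_def character_def \<gamma>0_def)
  then show ?thesis
    using least cnt ordLeq_transitive[OF least(2)] by metis
qed


section \<open>Topological gyrogroups\<close>

locale topological_gyrogroup = gyrogroup G gyr
  for G (structure) and gyr :: "'a \<Rightarrow> 'a \<Rightarrow> 'a \<Rightarrow> 'a" +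
  fixes T :: "'a topology"
  assumes topspace_eq: "topspace T = carrier G"
    and continuous_op: "continuous_map (prod_topology T T) T (\<lambda>(x, y). x \<otimes> y)"
    and continuous_inverse: "continuous_map T T (\<lambda>x. inv x)"
    and t1: "t1_space T"

locale strongly_topological_gyrogroup = topological_gyrogroup G gyr T
  for G (structure) and gyr :: "'a \<Rightarrow> 'a \<Rightarrow> 'a \<Rightarrow> 'a" and T :: "'a topology" +
  assumes gyr_invariant_base:
    "\<exists>\<U>. neighbourhood_base T \<one> \<U> \<and>
         (\<forall>U\<in>\<U>. \<forall>x\<in>carrier G. \<forall>y\<in>carrier G. gyr x y ` U = U)"

locale feathered_topological_gyrogroup = topological_gyrogroup G gyr T
  for G (structure) and gyr :: "'a \<Rightarrow> 'a \<Rightarrow> 'a \<Rightarrow> 'a" and T :: "'a topology" +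
  assumes feathered: "\<exists>K. K \<noteq> {} \<and> compactin T K \<and> countable_character T K"

end

theory Submission
  imports Defs
begin

text \<open>
  Choosing gyration-invariant neighbourhoods \<open>V n\<close> of the identity with
  \<open>V (Suc n) \<oplus> V (Suc n) \<subseteq> V n\<close>, each inside the \<open>n\<close>-th member of a base at a (translated)
  compact set \<open>K \<ni> 0\<close>, yields a closed subset \<open>H = \<Inter>n. V n\<close> of \<open>K\<close> for which the \<open>V n\<close> form a
  base. Invariance under gyrations makes the relations \<open>\<ominus>x \<oplus> y \<in> V n\<close> a countable
  base of a uniformity, so every open cover closed under finite unions is refined by a cover that is
  open for this uniformity. M. E. Rudin's proof of Stone's theorem uses nothing about a
  metric beyond such a sequence of entourages; cutting the resulting locally finite
  refinement with the finitely many sets of each union gives paracompactness. This replaces the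
  perfect map onto the metrizable quotient \<open>G/H\<close>.
\<close>

section \<open>Stone's theorem for a sequence of entourages\<close>

lemma ex_order_with_least_elements:
  "\<exists>r :: ('i \<times> 'i) set. antisym r \<and> (\<forall>A. A \<noteq> {} \<longrightarrow> (\<exists>i\<in>A. \<forall>j\<in>A. (i, j) \<in> r))"
proof -
  \<comment> \<open>A well-order of the whole index type. Least elements will choose an index for
    each point, and antisymmetry will make that choice unique.\<close>
  obtain r :: "('i \<times> 'i) set" where r: "well_order_on (Field r) r" "Field r = UNIV"
    using well_ordering by metis
  then have wo: "wo_rel r" by (simp only: wo_rel_def)
  have "\<exists>i\<in>A. \<forall>j\<in>A. (i, j) \<in> r" if "A \<noteq> {}" for A
    using wo_rel.minim_in[OF wo, of A] wo_rel.minim_least[OF wo, of A] that r(2)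
    by (intro bexI[of _ "wo_rel.minim r A"]) auto
  then show ?thesis using wo_rel.ANTISYM[OF wo] by (intro exI[of _ r]) simp
qed

text \<open>Rudin's construction, with \<open>B n x\<close> in the role of the ball of radius
  \<open>2^-n\<close>. Stage \<open>n\<close> places balls around points missed by all earlier
  stages, each assigned to the least possible index. Local finiteness counts indices
  \<open>p\<close>, so that each \<open>D p\<close> can later be cut into finitely many
  pieces.\<close>

lemma uniform_cover_locally_finite_refinement:
  fixes X :: "'a topology" and B :: "nat \<Rightarrow> 'a \<Rightarrow> 'a set" and C :: "'i \<Rightarrow> 'a set"
  assumes B_sub: "\<And>n x. B n x \<subseteq> topspace X"
    and B_refl: "\<And>n x. x \<in> topspace X \<Longrightarrow> x \<in> B n x"
    and B_sym: "\<And>n x y. \<lbrakk>x \<in> topspace X; y \<in> B n x\<rbrakk> \<Longrightarrow> x \<in> B n y"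
    and B_half: "\<And>n x y z. \<lbrakk>x \<in> topspace X; y \<in> B (Suc n) x; z \<in> B (Suc n) y\<rbrakk> \<Longrightarrow> z \<in> B n x"
    and B_nbhd: "\<And>n x. x \<in> topspace X \<Longrightarrow> \<exists>W. openin X W \<and> x \<in> W \<and> W \<subseteq> B n x"
    and cover: "\<And>x. x \<in> topspace X \<Longrightarrow> \<exists>i n. B n x \<subseteq> C i"
  obtains D :: "'i \<times> nat \<Rightarrow> 'a set"
  where "\<And>p. openin X (D p)" and "(\<Union>p. D p) = topspace X"
    and "\<And>i n. D (i, n) \<subseteq> C i"
    and "\<And>x. x \<in> topspace X \<Longrightarrow>
           \<exists>W. openin X W \<and> x \<in> W \<and> finite {p. D p \<inter> W \<noteq> {}}"
proof -
  have B_Suc: "B (Suc n) x \<subseteq> B n x" if "x \<in> topspace X" for n x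
    using B_half B_refl that by blast
  have B_mono: "B n x \<subseteq> B m x" if "x \<in> topspace X" "m \<le> n" for m n x
    using that(2) by (induction n rule: dec_induct) (use B_Suc[OF that(1)] in blast)+

  \<comment> \<open>The interior of \<open>A\<close> in the uniform topology. Since
    \<open>B n x\<close> need not be open, \<open>I (B n x)\<close> takes the place of the open
    ball.\<close>
  define I where "I A = {x \<in> topspace X. \<exists>n. B n x \<subseteq> A}" for A
  have I_top: "I A \<subseteq> topspace X" and I_sub: "I A \<subseteq> A" for A
    using B_refl by (auto simp: I_def)
  have I_ball: "\<exists>n. B n x \<subseteq> I A" if "x \<in> I A" for x A
  proof -
    from that obtain n where n: "x \<in> topspace X" "B n x \<subseteq> A" by (auto simp: I_def)
    have "B (Suc n) y \<subseteq> A" if "y \<in> B (Suc n) x" for y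
      using B_half[OF n(1) that] n(2) by blast
    then have "B (Suc n) x \<subseteq> I A" using B_sub[of "Suc n" x] by (auto simp: I_def)
    then show ?thesis ..
  qed
  have I_open: "openin X (I A)" for A
  proof (subst openin_subopen, intro ballI)
    fix x assume x: "x \<in> I A"
    then obtain n where "B n x \<subseteq> I A" using I_ball by blast
    then show "\<exists>W. openin X W \<and> x \<in> W \<and> W \<subseteq> I A"
      using B_nbhd[of x n] x I_top by blast
  qed
  have I_B: "x \<in> I (B n x)" if "x \<in> topspace X" for x n
    using that by (auto simp: I_def)

  obtain r :: "('i \<times> 'i) set" where r: "antisym r"
      "\<And>A. A \<noteq> {} \<Longrightarrow> \<exists>i\<in>A. \<forall>j\<in>A. (i, j) \<in> r"
    using ex_order_with_least_elements by metis
  define first where "first x i \<longleftrightarrow> x \<in> I (C i) \<and> (\<forall>j. x \<in> I (C j) \<longrightarrow> (i, j) \<in> r)" for x i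
  have ex_first: "\<exists>i. first x i" if "x \<in> topspace X" for x
  proof -
    have "{i. x \<in> I (C i)} \<noteq> {}" using cover[OF that] that by (auto simp: I_def)
    then show ?thesis using r(2)[of "{i. x \<in> I (C i)}"] by (auto simp: first_def)
  qed

  \<comment> \<open>The iterated balls stand for the ball of radius \<open>3 * 2^-n\<close>. The set
    \<open>Q\<close> holds the points covered before stage \<open>n\<close>; as a parameter it lets
    \<open>P\<close> be defined by primitive recursion, ahead of \<open>D\<close>.\<close>
  define centre where "centre Q i n x \<longleftrightarrow> x \<in> topspace X \<and> x \<notin> Q \<and> first x i \<and>
      (\<forall>p\<in>B n x. \<forall>q\<in>B n p. B n q \<subseteq> I (C i))" for Q i n x
  define F where "F Q i n = (\<Union>x\<in>{x. centre Q i n x}. I (B n x))" for Q i n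
  define P where "P = rec_nat {} (\<lambda>n Q. Q \<union> (\<Union>i. F Q i n))"
  define D where "D = (\<lambda>(i, n). F (P n) i n)"
  have P_Suc: "P (Suc n) = P n \<union> (\<Union>i. D (i, n))" for n
    by (simp add: P_def D_def)
  have P_mono: "P m \<subseteq> P n" if "m \<le> n" for m n
    using that by (induction n rule: dec_induct) (auto simp: P_Suc)
  have D_P: "D (i, m) \<subseteq> P n" if "m < n" for i m n
    using P_mono[of "Suc m" n] that by (auto simp: P_Suc)
  have P_D: "\<exists>p. x \<in> D p" if "x \<in> P n" for x n
    using that by (induction n) (auto simp: P_Suc, simp add: P_def)
  have D_centre: "\<exists>y. centre (P n) i n y \<and> x \<in> B n y" if "x \<in> D (i, n)" for x i n
    using that I_sub by (fastforce simp: D_def F_def)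
  have D_ball: "\<exists>j. B j x \<subseteq> D p" if "x \<in> D p" for x p
  proof -
    obtain i n where p: "p = (i, n)" by (cases p)
    with that obtain y where y: "centre (P n) i n y" "x \<in> I (B n y)"
      by (auto simp: D_def F_def)
    then show ?thesis using I_ball[OF y(2)] by (fastforce simp: p D_def F_def)
  qed
  have D_open: "openin X (D p)" for p
    by (cases p) (auto simp: D_def F_def intro: I_open)
  have D_C: "D (i, n) \<subseteq> C i" for i n
  proof
    fix x assume "x \<in> D (i, n)"
    then obtain y where y: "centre (P n) i n y" "x \<in> B n y" using D_centre by blast
    moreover have "x \<in> topspace X" using y B_sub by blast
    ultimately have "x \<in> I (C i)" using B_refl[of x n] unfolding centre_def by blast
    then show "x \<in> C i" using I_sub by blast
  qed
  have D_cover: "\<exists>p. x \<in> D p" if x: "x \<in> topspace X" for x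
  proof -
    obtain i where i: "first x i" using ex_first x by blast
    then obtain n where n: "B n x \<subseteq> I (C i)" using I_ball[of x "C i"] unfolding first_def by blast
    \<comment> \<open>Three steps of level \<open>n + 2\<close> stay within one of level
      \<open>n\<close>: the first two combine to level \<open>n + 1\<close>, and the third is also a
      step of that level. So \<open>x\<close> is a centre itself unless an earlier stage covers
      it.\<close>
    let ?m = "Suc (Suc n)"
    have "B ?m q \<subseteq> I (C i)" if pq: "p \<in> B ?m x" "q \<in> B ?m p" for p q
    proof -
      have q: "q \<in> topspace X" using pq B_sub by blast
      have "q \<in> B (Suc n) x" using B_half[OF x pq] .
      then show ?thesis using B_half[OF x] B_Suc[OF q] n by blast
    qed
    then have "x \<in> P ?m \<or> centre (P ?m) i ?m x" using x i by (auto simp: centre_def)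
    then show ?thesis
    proof
      assume "centre (P ?m) i ?m x"
      then have "x \<in> D (i, ?m)" using I_B[OF x] by (auto simp: D_def F_def)
      then show ?thesis ..
    qed (rule P_D)
  qed
  have D_loc: "\<exists>W. openin X W \<and> x \<in> W \<and> finite {p. D p \<inter> W \<noteq> {}}"
    if x: "x \<in> topspace X" for x
  proof -
    obtain i0 n0 where "x \<in> D (i0, n0)" using D_cover[OF x] by (metis surj_pair)
    then obtain j where j: "B j x \<subseteq> D (i0, n0)" using D_ball by blast
    \<comment> \<open>\<open>k\<close> exceeds both \<open>n0\<close> and \<open>j\<close>: stages
      from \<open>k\<close> on come after \<open>D (i0, n0)\<close>, and their balls lie in those of
      level \<open>Suc j\<close>.\<close>
    define k where "k = Suc (n0 + j)"
    obtain W where W: "openin X W" "x \<in> W" "W \<subseteq> B k x" using B_nbhd[OF x] by blast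
    \<comment> \<open>Otherwise two steps of level \<open>Suc j\<close>, from \<open>x\<close> via
      \<open>p\<close>, put the centre \<open>y\<close> into \<open>B j x\<close>, hence into
      \<open>D (i0, n0)\<close> and \<open>P m\<close>, which centres of stage \<open>m\<close>
      avoid.\<close>
    have less: "m < k" if meet: "D (i, m) \<inter> W \<noteq> {}" for i m
    proof (rule ccontr)
      assume "\<not> m < k"
      then have le: "k \<le> m" "Suc j \<le> m" "n0 < m" by (auto simp: k_def)
      obtain p where p: "p \<in> D (i, m)" "p \<in> B k x" using meet W by blast
      obtain y where y: "centre (P m) i m y" "p \<in> B m y" using D_centre p by blast
      have top: "p \<in> topspace X" "y \<in> topspace X"
        using y B_sub by (auto simp: centre_def)
      have "p \<in> B (Suc j) x" using p(2) B_mono[OF x, of "Suc j" k] by (auto simp: k_def)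
      moreover have "y \<in> B (Suc j) p"
        using B_sym[OF top(2) y(2)] B_mono[OF top(1) le(2)] by blast
      ultimately have "y \<in> P m" using B_half[OF x] j D_P[OF le(3)] by blast
      then show False using y by (simp add: centre_def)
    qed
    \<comment> \<open>Going through \<open>x\<close> shows that \<open>q\<close> is in
      \<open>B m p\<close>. So \<open>y\<close>, \<open>p\<close>, \<open>q\<close>,
      \<open>z\<close> is a chain of three steps of level \<open>m\<close>, as allowed for in
      \<open>centre\<close>.\<close>
    have near: "z \<in> I (C i)"
      if pq: "p \<in> B k x" "q \<in> B k x" and "m < k" and y: "centre (P m) i m y" "p \<in> B m y"
        and z: "z \<in> topspace X" "q \<in> B m z" for p q i m y z
    proof -
      have le: "Suc m \<le> k" using that by simp
      have top: "p \<in> topspace X" "q \<in> topspace X" using pq B_sub by auto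
      have "x \<in> B (Suc m) p" using B_sym[OF x pq(1)] B_mono[OF top(1) le] by blast
      moreover have "q \<in> B (Suc m) x" using pq(2) B_mono[OF x le] by blast
      ultimately have "q \<in> B m p" using B_half[OF top(1)] by blast
      moreover have "z \<in> B m q" using B_sym[OF z] .
      ultimately show ?thesis using y by (auto simp: centre_def)
    qed
    \<comment> \<open>By \<open>near\<close>, each of the two centres lies in the uniform interior
      that belongs to the other's index. Both indices are least, so antisymmetry identifies
      them.\<close>
    have unique: "i = i'" if meet: "D (i, m) \<inter> W \<noteq> {}" "D (i', m) \<inter> W \<noteq> {}" for i i' m
    proof -
      obtain p q where p: "p \<in> D (i, m)" "p \<in> B k x" and q: "q \<in> D (i', m)" "q \<in> B k x"
        using meet W by blast
      obtain y z where y: "centre (P m) i m y" "p \<in> B m y"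
          and z: "centre (P m) i' m z" "q \<in> B m z"
        using D_centre[OF p(1)] D_centre[OF q(1)] by blast
      have "z \<in> I (C i)" "y \<in> I (C i')"
        using near[OF p(2) q(2) less[OF meet(1)] y _ z(2)]
          near[OF q(2) p(2) less[OF meet(1)] z _ y(2)] y z
        by (auto simp: centre_def)
      then show ?thesis using y z r(1) by (auto simp: centre_def first_def antisym_def)
    qed
    \<comment> \<open>At most one index per stage, and only stages below \<open>k\<close>.\<close>
    have "inj_on snd {p. D p \<inter> W \<noteq> {}}" using unique by (auto simp: inj_on_def)
    moreover have "snd ` {p. D p \<inter> W \<noteq> {}} \<subseteq> {..<k}" using less by fastforce
    ultimately have "finite {p. D p \<inter> W \<noteq> {}}" by (rule inj_on_finite) simp
    with W show ?thesis by blast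
  qed
  have "(\<Union>p. D p) = topspace X" using D_cover openin_subset[OF D_open] by blast
  then show thesis by (rule that[OF D_open _ D_C D_loc])
qed

text \<open>The finite unions of members of \<U> form a cover to which the preceding refinement
  applies. Intersecting each \<open>D (\<F>, n)\<close> with the finitely many members of \<F>
  refines \<U> itself and keeps local finiteness.\<close>

lemma paracompact_space_if_finite_unions_uniform:
  fixes X :: "'a topology" and B :: "nat \<Rightarrow> 'a \<Rightarrow> 'a set"
  assumes B_sub: "\<And>n x. B n x \<subseteq> topspace X"
    and B_refl: "\<And>n x. x \<in> topspace X \<Longrightarrow> x \<in> B n x"
    and B_sym: "\<And>n x y. \<lbrakk>x \<in> topspace X; y \<in> B n x\<rbrakk> \<Longrightarrow> x \<in> B n y"
    and B_half: "\<And>n x y z. \<lbrakk>x \<in> topspace X; y \<in> B (Suc n) x; z \<in> B (Suc n) y\<rbrakk> \<Longrightarrow> z \<in> B n x"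
    and B_nbhd: "\<And>n x. x \<in> topspace X \<Longrightarrow> \<exists>W. openin X W \<and> x \<in> W \<and> W \<subseteq> B n x"
    and finite_unions: "\<And>\<U> x. \<lbrakk>\<And>U. U \<in> \<U> \<Longrightarrow> openin X U; \<Union>\<U> = topspace X; x \<in> topspace X\<rbrakk>
      \<Longrightarrow> \<exists>\<F> n. finite \<F> \<and> \<F> \<subseteq> \<U> \<and> B n x \<subseteq> \<Union>\<F>"
  shows "paracompact_space X"
  unfolding paracompact_space_def
proof (intro allI impI, elim conjE)
  fix \<U> assume \<U>: "\<forall>U\<in>\<U>. openin X U" "\<Union>\<U> = topspace X"
  \<comment> \<open>The refinement is indexed by a whole type, so families that are infinite or not
    contained in \<U> are given the empty union.\<close>
  define fin where "fin \<F> = (if finite \<F> \<and> \<F> \<subseteq> \<U> then \<F> else {})" for \<F>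
  have fin: "finite (fin \<F>)" "fin \<F> \<subseteq> \<U>" for \<F> by (auto simp: fin_def)
  have cover: "\<exists>\<F> n. B n x \<subseteq> \<Union>(fin \<F>)" if "x \<in> topspace X" for x
    using finite_unions[of \<U> x] \<U> that unfolding fin_def by metis
  obtain D :: "'a set set \<times> nat \<Rightarrow> 'a set" where
      D: "\<And>p. openin X (D p)" "(\<Union>p. D p) = topspace X" "\<And>\<F> n. D (\<F>, n) \<subseteq> \<Union>(fin \<F>)"
        "\<And>x. x \<in> topspace X \<Longrightarrow> \<exists>W. openin X W \<and> x \<in> W \<and> finite {p. D p \<inter> W \<noteq> {}}"
    by (rule uniform_cover_locally_finite_refinement
        [where X = X and B = B and C = "\<lambda>\<F>. \<Union>(fin \<F>)"])
      (rule B_sub, erule B_refl, erule (1) B_sym, erule (2) B_half, erule B_nbhd, erule cover, rule that)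
  define \<V> where "\<V> = (\<Union>p. (\<inter>) (D p) ` fin (fst p))"
  have opn: "\<forall>V\<in>\<V>. openin X V"
    using D(1) fin(2) \<U>(1) by (fastforce simp: \<V>_def)
  have cov: "\<Union>\<V> = topspace X"
  proof
    show "\<Union>\<V> \<subseteq> topspace X" using opn openin_subset by blast
    show "topspace X \<subseteq> \<Union>\<V>"
    proof
      fix x assume "x \<in> topspace X"
      then obtain \<F> n where "x \<in> D (\<F>, n)" using D(2) by (metis UN_E surj_pair)
      moreover then obtain U where "U \<in> fin \<F>" "x \<in> U" using D(3) by blast
      ultimately show "x \<in> \<Union>\<V>" unfolding \<V>_def by force
    qed
  qed
  have loc: "locally_finite_in X \<V>"
    unfolding locally_finite_in_def
  proof (intro conjI ballI)
    show "\<Union>\<V> \<subseteq> topspace X" using cov by simp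
    fix x assume "x \<in> topspace X"
    then obtain W where W: "openin X W" "x \<in> W" "finite {p. D p \<inter> W \<noteq> {}}" using D(4) by blast
    have "{V \<in> \<V>. V \<inter> W \<noteq> {}} \<subseteq> (\<Union>p\<in>{p. D p \<inter> W \<noteq> {}}. (\<inter>) (D p) ` fin (fst p))"
      unfolding \<V>_def by blast
    then have "finite {V \<in> \<V>. V \<inter> W \<noteq> {}}"
      by (rule finite_subset) (use W(3) fin(1) in auto)
    with W show "\<exists>V. openin X V \<and> x \<in> V \<and> finite {U \<in> \<V>. U \<inter> V \<noteq> {}}" by blast
  qed
  have "\<forall>V\<in>\<V>. \<exists>U\<in>\<U>. V \<subseteq> U" using fin(2) unfolding \<V>_def by blast
  with opn cov loc show "\<exists>\<V>. (\<forall>V\<in>\<V>. openin X V) \<and> \<Union>\<V> = topspace X \<and>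
      (\<forall>V\<in>\<V>. \<exists>U\<in>\<U>. V \<subseteq> U) \<and> locally_finite_in X \<V>"
    by blast
qed

section \<open>Cancellation laws in gyrogroups\<close>

context gyrogroup
begin

lemma inverse:
  assumes "x \<in> carrier G"
  shows "inv x \<in> carrier G" "inv x \<otimes> x = \<one>" "x \<otimes> inv x = \<one>"
proof -
  have "\<exists>!y. y \<in> carrier G \<and> x \<otimes> y = \<one> \<and> y \<otimes> x = \<one>"
    using ex1_inverse[OF assms] by (simp add: conj_commute)
  from theI'[OF this] show "inv x \<in> carrier G" "inv x \<otimes> x = \<one>" "x \<otimes> inv x = \<one>"
    by (auto simp: m_inv_def)
qed

lemma inverse_one: "inv \<one> = \<one>"
  using inverse[OF zero_closed] left_zero by metis

lemma gyr_inj: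
  assumes "x \<in> carrier G" "y \<in> carrier G" shows "inj_on (gyr x y) (carrier G)"
  using gyr_automorphism[OF assms] by (simp add: iso_def bij_betw_def)

lemma gyr_closed:
  assumes "x \<in> carrier G" "y \<in> carrier G" "z \<in> carrier G"
  shows "gyr x y z \<in> carrier G"
  using gyr_automorphism[OF assms(1,2)] assms(3) by (auto simp: iso_def hom_def)

text \<open>Adding \<open>inv x\<close> on the left and regrouping leaves
  \<open>gyr (inv x) x\<close> applied to both elements, and gyrations are injective.\<close>

lemma left_cancel_eq:
  assumes "x \<in> carrier G" "a \<in> carrier G" "b \<in> carrier G" "x \<otimes> a = x \<otimes> b"
  shows "a = b"
proof -
  note [simp] = inverse[OF assms(1)] assms
  have "inv x \<otimes> (x \<otimes> a) = inv x \<otimes> (x \<otimes> b)" by (simp only: assms)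
  then have "gyr (inv x) x a = gyr (inv x) x b"
    by (simp del: assms(4) add: gyroassociative left_zero gyr_closed)
  then show ?thesis using gyr_inj[of "inv x" x] by (auto dest: inj_onD)
qed

lemma gyr_one_left:
  assumes "x \<in> carrier G" "z \<in> carrier G" shows "gyr \<one> x z = z"
proof (rule left_cancel_eq)
  show "x \<otimes> gyr \<one> x z = x \<otimes> z"
    using gyroassociative[OF zero_closed assms] assms by (simp add: left_zero op_closed)
qed (use assms zero_closed gyr_closed in auto)

text \<open>The loop property turns \<open>gyr (inv x) x\<close> into \<open>gyr \<one> x\<close>,
  which is the identity on the carrier.\<close>

lemma left_inverse_cancel:
  assumes "x \<in> carrier G" "y \<in> carrier G" shows "inv x \<otimes> (x \<otimes> y) = y"
proof -
  have "gyr (inv x) x y = y"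
    using loop_property[of "inv x" x y] gyr_one_left[of x y] assms by (simp add: inverse)
  then show ?thesis using assms by (simp add: gyroassociative inverse left_zero)
qed

lemma left_cancel_inverse:
  assumes "x \<in> carrier G" "y \<in> carrier G" shows "x \<otimes> (inv x \<otimes> y) = y"
proof -
  have "inv (inv x) = x"
    using left_inverse_cancel[of "inv x" x] assms by (simp add: inverse right_zero)
  then show ?thesis using left_inverse_cancel[of "inv x" y] assms by (simp add: inverse)
qed

text \<open>Replaces the group identity that splits a quotient at an intermediate point
  \<open>y\<close>; the second factor is twisted by a gyration.\<close>

lemma inverse_op_split:
  assumes "x \<in> carrier G" "y \<in> carrier G" "z \<in> carrier G"
  shows "inv x \<otimes> z = (inv x \<otimes> y) \<otimes> gyr (inv x) y (inv y \<otimes> z)"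
  using gyroassociative[of "inv x" y "inv y \<otimes> z"] assms
  by (simp add: inverse op_closed left_cancel_inverse)

end

section \<open>Translating the compact set to the identity\<close>

context topological_gyrogroup
begin

lemma continuous_map_op:
  assumes "continuous_map X T f" "continuous_map X T g"
  shows "continuous_map X T (\<lambda>x. f x \<otimes> g x)"
proof -
  have "continuous_map X (prod_topology T T) (\<lambda>x. (f x, g x))"
    using assms by (simp add: continuous_map_paired)
  from continuous_map_compose[OF this continuous_op] show ?thesis by (simp add: o_def)
qed

lemma continuous_map_left_translation:
  assumes "x \<in> carrier G" shows "continuous_map T T (\<lambda>y. x \<otimes> y)"
  by (rule continuous_map_op) (use assms topspace_eq in auto)

lemma continuous_map_inverse_op:
  assumes "x \<in> carrier G" shows "continuous_map T T (\<lambda>y. inv y \<otimes> x)"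
  by (rule continuous_map_op) (use assms topspace_eq continuous_inverse in auto)

text \<open>For \<open>k \<in> K\<close>, left translation by \<open>inv k\<close> is a
  homeomorphism with inverse \<open>y \<mapsto> k \<otimes> y\<close>, so it carries
  \<open>K\<close> and a countable base at \<open>K\<close> to a compact set through the identity
  and a base there.\<close>

lemma feathered_at_one:
  assumes "K \<noteq> {}" "compactin T K" "countable_character T K"
  obtains K' and O' :: "nat \<Rightarrow> 'a set" where
    "compactin T K'" "\<one> \<in> K'" "\<And>n. openin T (O' n)" "\<And>n. K' \<subseteq> O' n"
    "\<And>W. \<lbrakk>openin T W; K' \<subseteq> W\<rbrakk> \<Longrightarrow> \<exists>n. O' n \<subseteq> W"
proof -
  obtain \<gamma> where \<gamma>: "base_at T K \<gamma>" "countable \<gamma>"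
    using assms(3) unfolding countable_character_iff by blast
  have K_sub: "K \<subseteq> carrier G" using compactin_subset_topspace[OF assms(2)] topspace_eq by simp
  then have "\<gamma> \<noteq> {}" using \<gamma>(1) topspace_eq unfolding base_at_def
    by (metis empty_iff openin_topspace)
  then obtain U :: "nat \<Rightarrow> 'a set" where U: "range U = \<gamma>"
    using uncountable_def \<gamma>(2) by metis
  obtain k where k: "k \<in> K" using assms(1) by blast
  have kG: "k \<in> carrier G" "inv k \<in> carrier G" using k K_sub inverse by auto
  \<comment> \<open>The translate of \<open>U n\<close> by \<open>inv k\<close>, written as a
    preimage so that its openness is continuity.\<close>
  define O' where "O' n = {x \<in> topspace T. k \<otimes> x \<in> U n}" for n
  define K' where "K' = (\<lambda>x. inv k \<otimes> x) ` K"
  show thesis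
  proof
    show "compactin T K'"
      unfolding K'_def
      by (rule image_compactin[OF assms(2) continuous_map_left_translation[OF kG(2)]])
    show "\<one> \<in> K'" using k inverse[OF kG(1)] by (force simp: K'_def)
    show "openin T (O' n)" for n
      unfolding O'_def
      by (rule openin_continuous_map_preimage[OF continuous_map_left_translation[OF kG(1)]])
        (use U \<gamma> in \<open>auto simp: base_at_def\<close>)
    show "K' \<subseteq> O' n" for n
    proof -
      have "K \<subseteq> U n" using U \<gamma>(1) by (auto simp: base_at_def)
      then show ?thesis
        using K_sub kG left_cancel_inverse[OF kG(1)] op_closed
        by (auto simp: K'_def O'_def topspace_eq subset_iff)
    qed
    fix W assume W: "openin T W" "K' \<subseteq> W"
    have "openin T {x \<in> topspace T. inv k \<otimes> x \<in> W}"
      by (rule openin_continuous_map_preimage[OF continuous_map_left_translation[OF kG(2)] W(1)])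
    moreover have "K \<subseteq> {x \<in> topspace T. inv k \<otimes> x \<in> W}"
      using W(2) K_sub topspace_eq by (auto simp: K'_def)
    ultimately obtain n where "U n \<subseteq> {x \<in> topspace T. inv k \<otimes> x \<in> W}"
      using \<gamma>(1) U unfolding base_at_def by (metis (no_types, lifting) imageE)
    then have "O' n \<subseteq> W"
      using left_inverse_cancel[OF kG(1)] topspace_eq by (force simp: O'_def)
    then show "\<exists>n. O' n \<subseteq> W" ..
  qed
qed

end

section \<open>Gyration-invariant neighbourhoods and their uniformity\<close>

context strongly_topological_gyrogroup
begin

definition invariant_nbhd :: "'a set \<Rightarrow> bool" where
  "invariant_nbhd V \<longleftrightarrow> V \<subseteq> carrier G \<and> (\<exists>W. openin T W \<and> \<one> \<in> W \<and> W \<subseteq> V) \<and>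
     (\<forall>x\<in>carrier G. \<forall>y\<in>carrier G. gyr x y ` V \<subseteq> V)"

lemma ex_invariant_nbhd:
  assumes "openin T W" "\<one> \<in> W" shows "\<exists>V. invariant_nbhd V \<and> V \<subseteq> W"
proof -
  obtain \<U> where \<U>: "neighbourhood_base T \<one> \<U>"
      "\<forall>U\<in>\<U>. \<forall>x\<in>carrier G. \<forall>y\<in>carrier G. gyr x y ` U = U"
    using gyr_invariant_base by blast
  then obtain U where U: "U \<in> \<U>" "U \<subseteq> W" using assms unfolding neighbourhood_base_def by blast
  have "U \<subseteq> carrier G" "\<exists>W. openin T W \<and> \<one> \<in> W \<and> W \<subseteq> U"
    using \<U>(1) U(1) topspace_eq by (auto simp: neighbourhood_base_def)
  moreover have "gyr x y ` U \<subseteq> U" if "x \<in> carrier G" "y \<in> carrier G" for x y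
    using \<U>(2) U(1) that by blast
  ultimately have "invariant_nbhd U" by (simp add: invariant_nbhd_def)
  then show ?thesis using U by blast
qed

lemma one_in_invariant_nbhd: "invariant_nbhd V \<Longrightarrow> \<one> \<in> V"
  by (auto simp: invariant_nbhd_def)

lemma ex_invariant_nbhd_half:
  assumes "invariant_nbhd V" "openin T W" "\<one> \<in> W"
  shows "\<exists>V'. invariant_nbhd V' \<and> V' \<subseteq> W \<and> (\<forall>x\<in>V'. \<forall>y\<in>V'. x \<otimes> y \<in> V)"
proof -
  obtain A where A: "openin T A" "\<one> \<in> A" "A \<subseteq> V" using assms(1) by (auto simp: invariant_nbhd_def)
  define S where "S = {p \<in> topspace (prod_topology T T). (case p of (x, y) \<Rightarrow> x \<otimes> y) \<in> A}"
  have S: "openin (prod_topology T T) S"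
    unfolding S_def by (rule openin_continuous_map_preimage[OF continuous_op A(1)])
  have "(\<one>, \<one>) \<in> S" using A zero_closed by (auto simp: S_def topspace_eq left_zero)
  from S[unfolded openin_prod_topology_alt, rule_format, OF this]
  obtain M N where MN: "openin T M" "openin T N" "\<one> \<in> M" "\<one> \<in> N" "M \<times> N \<subseteq> S"
    by auto
  have "openin T (M \<inter> N \<inter> W)" "\<one> \<in> M \<inter> N \<inter> W" using MN assms by auto
  then obtain V' where V': "invariant_nbhd V'" "V' \<subseteq> M \<inter> N \<inter> W"
    using ex_invariant_nbhd by blast
  have "x \<otimes> y \<in> V" if "x \<in> V'" "y \<in> V'" for x y
  proof -
    have "(x, y) \<in> S" using that V'(2) MN(5) by blast
    then show ?thesis using A(3) by (auto simp: S_def)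
  qed
  then show ?thesis using V' by blast
qed

text \<open>Dependent choice imposes the \<open>n\<close>-th constraint on the passage from
  \<open>V n\<close> to \<open>V (Suc n)\<close>, whence the shift against \<open>W\<close>;
  \<open>V 0\<close> is an arbitrary invariant neighbourhood.\<close>

lemma invariant_nbhd_halving_sequence:
  assumes "\<And>n. openin T (W n)" "\<And>n. \<one> \<in> W n"
  obtains V :: "nat \<Rightarrow> 'a set" where "\<And>n. invariant_nbhd (V n)" "\<And>n. V (Suc n) \<subseteq> W n"
    "\<And>n x y. \<lbrakk>x \<in> V (Suc n); y \<in> V (Suc n)\<rbrakk> \<Longrightarrow> x \<otimes> y \<in> V n"
proof -
  have "\<exists>V. \<forall>n. invariant_nbhd (V n) \<and>
      (V (Suc n) \<subseteq> W n \<and> (\<forall>x\<in>V (Suc n). \<forall>y\<in>V (Suc n). x \<otimes> y \<in> V n))"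
  proof (rule dependent_nat_choice)
    show "\<exists>V. invariant_nbhd V" using ex_invariant_nbhd[OF assms] by blast
    show "\<exists>V'. invariant_nbhd V' \<and> V' \<subseteq> W n \<and> (\<forall>x\<in>V'. \<forall>y\<in>V'. x \<otimes> y \<in> V)"
      if "invariant_nbhd V" for V n
      using ex_invariant_nbhd_half[OF that assms] .
  qed
  then show thesis using that by blast
qed

text \<open>The triangle inequality: invariance of \<open>V'\<close> absorbs the gyration from
  \<open>inverse_op_split\<close>.\<close>

lemma inverse_op_in_if_half:
  assumes "invariant_nbhd V'" and half: "\<And>x y. \<lbrakk>x \<in> V'; y \<in> V'\<rbrakk> \<Longrightarrow> x \<otimes> y \<in> V"
    and "x \<in> carrier G" "y \<in> carrier G" "z \<in> carrier G"
    and "inv x \<otimes> y \<in> V'" "inv y \<otimes> z \<in> V'"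
  shows "inv x \<otimes> z \<in> V"
proof -
  have "gyr (inv x) y (inv y \<otimes> z) \<in> V'"
    using assms inverse[OF assms(3)] unfolding invariant_nbhd_def by blast
  then show ?thesis using half[OF assms(6)] inverse_op_split[OF assms(3-5)] by simp
qed

text \<open>For the compact set \<open>H\<close> built below, finitely many members of an open cover
  contain the translate of \<open>H\<close> by \<open>x\<close>. As the \<open>V n\<close> form a
  base at \<open>H\<close>, they contain a whole ball around \<open>x\<close>.\<close>

lemma paracompact_if_compact_with_countable_base:
  fixes W :: "nat \<Rightarrow> 'a set"
  assumes K: "compactin T K" "\<one> \<in> K"
    and W: "\<And>n. openin T (W n)" "\<And>n. K \<subseteq> W n"
    and base: "\<And>A. \<lbrakk>openin T A; K \<subseteq> A\<rbrakk> \<Longrightarrow> \<exists>n. W n \<subseteq> A"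
  shows "paracompact_space T"
proof -
  obtain V where V: "\<And>n. invariant_nbhd (V n)" "\<And>n. V (Suc n) \<subseteq> W n"
      and half: "\<And>n x y. \<lbrakk>x \<in> V (Suc n); y \<in> V (Suc n)\<rbrakk> \<Longrightarrow> x \<otimes> y \<in> V n"
    using invariant_nbhd_halving_sequence[of W] W K(2) by blast
  have V_sub: "V n \<subseteq> carrier G" for n using V(1) by (auto simp: invariant_nbhd_def)
  have V_Suc: "V (Suc n) \<subseteq> V n" for n
    using half[OF _ one_in_invariant_nbhd[OF V(1)]] V_sub right_zero by (metis subset_iff)
  have V_mono: "V n \<subseteq> V m" if "m \<le> n" for m n
    using that by (induction n rule: dec_induct) (use V_Suc in blast)+
  \<comment> \<open>Both quotients are required because \<open>V n\<close> need not be
    symmetric.\<close>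
  define B where "B n x = {y \<in> carrier G. inv x \<otimes> y \<in> V n \<and> inv y \<otimes> x \<in> V n}" for n x
  have B_half: "z \<in> B n x"
    if "x \<in> carrier G" "y \<in> B (Suc n) x" "z \<in> B (Suc n) y" for n x y z
    using that inverse_op_in_if_half[OF V(1)[of "Suc n"] half]
    unfolding B_def by blast
  have B_nbhd: "\<exists>A. openin T A \<and> x \<in> A \<and> A \<subseteq> B n x" if x: "x \<in> carrier G" for n x
  proof -
    obtain N where N: "openin T N" "\<one> \<in> N" "N \<subseteq> V n" using V(1)[of n] by (auto simp: invariant_nbhd_def)
    let ?A = "{y \<in> topspace T. inv x \<otimes> y \<in> N} \<inter> {y \<in> topspace T. inv y \<otimes> x \<in> N}"
    have "openin T ?A"
      by (intro openin_Int openin_continuous_map_preimage[OF _ N(1)]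
          continuous_map_left_translation continuous_map_inverse_op inverse x)
    moreover have "x \<in> ?A" "?A \<subseteq> B n x"
      using x N inverse[OF x] by (auto simp: B_def topspace_eq)
    ultimately show ?thesis by blast
  qed

  \<comment> \<open>A ball around \<open>y\<close> meets \<open>V (Suc n)\<close> in some
    \<open>v\<close>; the triangle inequality from the identity via \<open>v\<close> to
    \<open>y\<close> costs one level.\<close>
  have closure: "T closure_of V (Suc n) \<subseteq> V n" for n
  proof
    fix y assume y: "y \<in> T closure_of V (Suc n)"
    then have yG: "y \<in> carrier G" by (simp add: in_closure_of topspace_eq)
    obtain A where "openin T A" "y \<in> A" "A \<subseteq> B (Suc n) y" using B_nbhd[OF yG] by blast
    then obtain v where v: "v \<in> V (Suc n)" "v \<in> B (Suc n) y"
      using y unfolding in_closure_of by blast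
    have "inv \<one> \<otimes> y \<in> V n"
      by (rule inverse_op_in_if_half[OF V(1)[of "Suc n"] half, where y = v])
        (use v yG zero_closed V_sub in \<open>auto simp: B_def inverse_one left_zero\<close>)
    then show "y \<in> V n" using yG by (simp add: inverse_one left_zero)
  qed
  define H where "H = (\<Inter>n. V n)"
  have H_closure: "H = (\<Inter>n. T closure_of V n)"
  proof
    show "H \<subseteq> (\<Inter>n. T closure_of V n)"
      using closure_of_subset[of "V _" T] V_sub topspace_eq unfolding H_def by blast
    show "(\<Inter>n. T closure_of V n) \<subseteq> H" using closure unfolding H_def by blast
  qed
  \<comment> \<open>By T1, a point outside \<open>K\<close> can be removed from the space, leaving
    an open set around \<open>K\<close>. Some \<open>W n\<close> then misses the point, while
    \<open>V (Suc n) \<subseteq> W n\<close> contains all of \<open>H\<close>.\<close>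
  have "H \<subseteq> K"
  proof
    fix x assume x: "x \<in> H"
    show "x \<in> K"
    proof (rule ccontr)
      assume "x \<notin> K"
      then have "K \<subseteq> topspace T - {x}" using compactin_subset_topspace[OF K(1)] by blast
      moreover have "openin T (topspace T - {x})"
        using t1 x V_sub topspace_eq
        by (metis t1_space_openin_delete_alt openin_topspace)
      ultimately obtain n where "W n \<subseteq> topspace T - {x}" using base by blast
      then show False using x V(2)[of n] by (auto simp: H_def)
    qed
  qed
  moreover have "closedin T H" unfolding H_closure by (auto intro: closedin_Inter)
  ultimately have H: "compactin T H" using closed_compactin[OF K(1)] by blast

  \<comment> \<open>\<open>A\<close> and the complements of the closures cover \<open>K\<close>. A
    finite subcover contains some \<open>W m\<close>, and a late \<open>V\<close> lies in
    \<open>W m\<close> but misses the finitely many complements, which leaves only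
    \<open>A\<close>.\<close>
  have H_base: "\<exists>n. V n \<subseteq> A" if A: "openin T A" "H \<subseteq> A" for A
  proof -
    define R where "R n = topspace T - T closure_of V n" for n
    have R_open: "openin T (R n)" for n by (simp add: R_def openin_diff)
    have "K \<subseteq> \<Union>(insert A (range R))"
      using A(2) compactin_subset_topspace[OF K(1)] unfolding H_closure R_def by blast
    then obtain \<F> where \<F>: "finite \<F>" "\<F> \<subseteq> insert A (range R)" "K \<subseteq> \<Union>\<F>"
      using compactinD[OF K(1), of "insert A (range R)"] A(1) R_open by blast
    obtain J where J: "finite J" "\<F> - {A} = R ` J"
      using finite_subset_image[of "\<F> - {A}" R UNIV] \<F>(1,2) by blast
    have "K \<subseteq> A \<union> (\<Union>n\<in>J. R n)" using \<F>(3) J(2) by blast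
    moreover have "openin T (A \<union> (\<Union>n\<in>J. R n))" using A(1) R_open by blast
    ultimately obtain m where m: "W m \<subseteq> A \<union> (\<Union>n\<in>J. R n)" using base by blast
    obtain k where k: "J \<subseteq> {..k}" using J(1) finite_nat_iff_bounded_le by blast
    have "V (max k (Suc m)) \<inter> R n = {}" if "n \<in> J" for n
    proof -
      have "V (max k (Suc m)) \<subseteq> V n" using that k by (intro V_mono) auto
      also have "V n \<subseteq> T closure_of V n"
        using closure_of_subset[of "V n" T] V_sub topspace_eq by simp
      finally show ?thesis by (auto simp: R_def)
    qed
    moreover have "V (max k (Suc m)) \<subseteq> W m" using V_mono[of "Suc m" "max k (Suc m)"] V(2)[of m] by simp
    ultimately have "V (max k (Suc m)) \<subseteq> A" using m by blast
    then show ?thesis ..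
  qed

  show ?thesis
  proof (rule paracompact_space_if_finite_unions_uniform[where B = B])
    fix \<U> x assume \<U>: "\<And>U. U \<in> \<U> \<Longrightarrow> openin T U" "\<Union>\<U> = topspace T" and x: "x \<in> topspace T"
    have xG: "x \<in> carrier G" using x topspace_eq by simp
    note L = continuous_map_left_translation[OF xG]
    have xH: "compactin T ((\<lambda>y. x \<otimes> y) ` H)" by (rule image_compactin[OF H L])
    have "(\<lambda>y. x \<otimes> y) ` H \<subseteq> \<Union>\<U>" using compactin_subset_topspace[OF xH] \<U>(2) by simp
    from compactinD[OF xH \<U>(1) this]
    obtain \<F> where \<F>: "finite \<F>" "\<F> \<subseteq> \<U>" "(\<lambda>y. x \<otimes> y) ` H \<subseteq> \<Union>\<F>"
      by auto
    have "openin T (\<Union>\<F>)" using \<U>(1) \<F>(2) by (intro openin_Union) auto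
    then have "openin T {y \<in> topspace T. x \<otimes> y \<in> \<Union>\<F>}"
      by (rule openin_continuous_map_preimage[OF L])
    moreover have "H \<subseteq> {y \<in> topspace T. x \<otimes> y \<in> \<Union>\<F>}"
      using \<F>(3) compactin_subset_topspace[OF H] by auto
    ultimately obtain n where n: "V n \<subseteq> {y \<in> topspace T. x \<otimes> y \<in> \<Union>\<F>}"
      using H_base by meson
    \<comment> \<open>Each \<open>y\<close> in the ball is the translate by \<open>x\<close> of
      \<open>inv x \<otimes> y \<in> V n\<close>.\<close>
    have "B n x \<subseteq> \<Union>\<F>"
    proof
      fix y assume "y \<in> B n x"
      then have "y \<in> carrier G" "inv x \<otimes> y \<in> V n" by (auto simp: B_def)
      then have "x \<otimes> (inv x \<otimes> y) \<in> \<Union>\<F>" using n by blast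
      then show "y \<in> \<Union>\<F>" using left_cancel_inverse[OF xG \<open>y \<in> carrier G\<close>] by simp
    qed
    then show "\<exists>\<F> n. finite \<F> \<and> \<F> \<subseteq> \<U> \<and> B n x \<subseteq> \<Union>\<F>" using \<F> by blast
  next
    fix n x
    show "B n x \<subseteq> topspace T" by (auto simp: B_def topspace_eq)
    assume "x \<in> topspace T"
    then have x: "x \<in> carrier G" by (simp add: topspace_eq)
    show "x \<in> B n x" using one_in_invariant_nbhd[OF V(1)] inverse[OF x] x by (simp add: B_def)
    show "\<exists>A. openin T A \<and> x \<in> A \<and> A \<subseteq> B n x" using B_nbhd[OF x] .
    show "x \<in> B n y" if "y \<in> B n x" for y using that x by (simp add: B_def)
    show "z \<in> B n x" if "y \<in> B (Suc n) x" "z \<in> B (Suc n) y" for y z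
      using B_half[OF x that] .
  qed
qed

end

theorem corollary3p15:
  fixes G :: "('a, 'b) monoid_scheme"
    and gyr :: "'a \<Rightarrow> 'a \<Rightarrow> 'a \<Rightarrow> 'a"
    and T :: "'a topology"
  assumes "strongly_topological_gyrogroup G gyr T"
    and "feathered_topological_gyrogroup G gyr T"
  shows "paracompact_space T"
proof -
  interpret strongly_topological_gyrogroup G gyr T by fact
  obtain K where "K \<noteq> {}" "compactin T K" "countable_character T K"
    using feathered_topological_gyrogroup.feathered[OF assms(2)] by blast
  then obtain K' O' where "compactin T K'" "\<one>\<^bsub>G\<^esub> \<in> K'"
      "\<And>n::nat. openin T (O' n)" "\<And>n. K' \<subseteq> O' n"
      "\<And>W. \<lbrakk>openin T W; K' \<subseteq> W\<rbrakk> \<Longrightarrow> \<exists>n. O' n \<subseteq> W"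
    by (rule feathered_at_one) blast
  then show ?thesis by (rule paracompact_if_compact_with_countable_base)
qed

end
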